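(* Let $f(z)=z+a_2z^2+a_3z^3+\cdots\in\mathcal{S}^{*}_{\arcsin}$, with logarithmic coefficients $\gamma_n$, and let $H_{2,1}(F_f/2)=\gamma_1\gamma_3-\gamma_2^2$. Then $$|H_{2,1}(F_f/2)|\le \frac{1}{4\pi^2}.$$ The inequality is sharp, i.e. there is a function in $\mathcal{S}^{*}_{\arcsin}$ for which equality holds.
   Context: Let $\Omega=\{z\in\mathbb{C}:|z|<1\}$. Let $\mathcal{A}$ be the family of analytic functions $f$ on $\Omega$ normalized by $f(z)=z+\sum_{n\ge 2}a_nz^n$, and let $\mathcal{S}\subset\mathcal{A}$ be the subclass of univalent (injective) functions. A Schwarz function is an analytic function $\omega$ on $\Omega$ with $\omega(0)=0$ and $|\omega(z)|\le 1$ for all $z\in\Omega$. For $g,h$ analytic in $\Omega$, $g\prec h$ ($g$ is subordinate to $h$) means there is a Schwarz function $\omega$ with $g(z)=h(\omega(z))$ for all $z\in\Omega$. With $\arcsin$ denoting the principal branch (analytic in $\Omega$, $\arcsin 0=0$), define $$\mathcal{S}^{*}_{\arcsin}=\left\{f\in\mathcal{S}:\ \frac{zf'(z)}{f(z)}\prec 1+\frac{2}{\pi}\arcsin z\right\},$$ where $zf'(z)/f(z)$ is understood to take the value $1$ at $z=0$. The logarithmic coefficients $\gamma_n$ of $f\in\mathcal{S}$ are defined by $F_f(z)=\log\frac{f(z)}{z}=2\sum_{n\ge 1}\gamma_nz^n$ (with $\log 1=0$). Explicitly, $\gamma_1=\frac12a_2$, $\gamma_2=\frac12\left(a_3-\frac12a_2^2\right)$,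 $\gamma_3=\frac12\left(a_4-a_2a_3+\frac13a_2^3\right)$. *)

theory Defs
  imports "HOL-Complex_Analysis.Complex_Analysis"
begin

text \<open>Functions on the disc are total functions; only their values on \<^term>\<open>unit_disc\<close> matter.\<close>

abbreviation unit_disc :: "complex set" where
  "unit_disc \<equiv> ball 0 1"

text \<open>The two conditions at \<open>0\<close> say that the Taylor expansion starts \<open>z + a\<^sub>2 z\<^sup>2 + \<dots>\<close>.\<close>

definition class_A :: "(complex \<Rightarrow> complex) set" where
  "class_A = {f. f holomorphic_on unit_disc \<and> f 0 = 0 \<and> deriv f 0 = 1}"

definition class_S :: "(complex \<Rightarrow> complex) set" where
  "class_S = {f \<in> class_A. inj_on f unit_disc}"

definition schwarz_function :: "(complex \<Rightarrow> complex) \<Rightarrow> bool" where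
  "schwarz_function \<omega> \<longleftrightarrow>
     \<omega> holomorphic_on unit_disc \<and> \<omega> 0 = 0 \<and> (\<forall>z\<in>unit_disc. norm (\<omega> z) \<le> 1)"

definition subordinate :: "(complex \<Rightarrow> complex) \<Rightarrow> (complex \<Rightarrow> complex) \<Rightarrow> bool" where
  "subordinate g h \<longleftrightarrow>
     g holomorphic_on unit_disc \<and> h holomorphic_on unit_disc \<and>
     (\<exists>\<omega>. schwarz_function \<omega> \<and> (\<forall>z\<in>unit_disc. g z = h (\<omega> z)))"

definition starlike_quotient :: "(complex \<Rightarrow> complex) \<Rightarrow> complex \<Rightarrow> complex" where
  "starlike_quotient f z = (if z = 0 then 1 else z * deriv f z / f z)"

definition S_star_arcsin :: "(complex \<Rightarrow> complex) set" where
  "S_star_arcsin =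
     {f \<in> class_S. subordinate (starlike_quotient f) (\<lambda>z. 1 + 2 / of_real pi * Arcsin z)}"

text \<open>
  \<open>F\<close> is the analytic branch of \<open>log (f z / z)\<close> on the whole disc with \<open>F 0 = 0\<close>. It need not
  agree with the principal branch \<^term>\<open>Ln\<close> away from \<open>0\<close>. By \<open>log_branch_ex\<close> and
  \<open>log_branch_unique\<close> below it exists and is unique on the disc for \<open>f\<close> in \<^term>\<open>class_S\<close>,
  so the choice in \<open>log_fun\<close> is harmless.
\<close>

definition is_log_branch :: "(complex \<Rightarrow> complex) \<Rightarrow> (complex \<Rightarrow> complex) \<Rightarrow> bool" where
  "is_log_branch f F \<longleftrightarrow>
     F holomorphic_on unit_disc \<and> F 0 = 0 \<and> (\<forall>z\<in>unit_disc - {0}. exp (F z) = f z / z)"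

definition log_fun :: "(complex \<Rightarrow> complex) \<Rightarrow> complex \<Rightarrow> complex" where
  "log_fun f = (SOME F. is_log_branch f F)"

text \<open>Half the \<open>n\<close>-th Taylor coefficient at \<open>0\<close>, since \<open>log_fun f z = 2 (\<Sum>n\<ge>1. \<gamma>\<^sub>n z\<^sup>n)\<close>;
  see \<open>log_coeff_sums\<close>.\<close>

definition log_coeff :: "(complex \<Rightarrow> complex) \<Rightarrow> nat \<Rightarrow> complex" where
  "log_coeff f n = (deriv ^^ n) (log_fun f) 0 / fact n / 2"

definition hankel_log_2_1 :: "(complex \<Rightarrow> complex) \<Rightarrow> complex" where
  "hankel_log_2_1 f = log_coeff f 1 * log_coeff f 3 - (log_coeff f 2)\<^sup>2"

lemma log_branch_ex:
  assumes "f \<in> class_S"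
  shows "\<exists>F. is_log_branch f F"
proof -
  have hol: "f holomorphic_on unit_disc" and f0: "f 0 = 0" and d1: "deriv f 0 = 1"
    and inj: "inj_on f unit_disc"
    using assms by (auto simp: class_S_def class_A_def)
  define q where "q = (\<lambda>z. if z = 0 then 1 else f z / z)"
  have q_hol: "q holomorphic_on unit_disc"
    by (rule pole_theorem_open_0[OF hol, of 0]) (auto simp: q_def f0 d1)
  have q_nz: "q z \<noteq> 0" if "z \<in> unit_disc" for z
    using that inj_onD[OF inj, of z 0] f0 by (auto simp: q_def)
  obtain G where G: "G holomorphic_on unit_disc" "\<And>z. z \<in> unit_disc \<Longrightarrow> q z = exp (G z)"
    using contractible_imp_holomorphic_log[OF q_hol convex_imp_contractible[OF convex_ball] q_nz]
    by blast
  have "exp (G 0) = 1"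
    using G(2)[of 0] by (simp add: q_def)
  moreover have "exp (G z) = f z / z" if "z \<in> unit_disc - {0}" for z
    using G(2)[of z] that by (simp add: q_def)
  ultimately have "is_log_branch f (\<lambda>z. G z - G 0)"
    using G(1) by (simp add: is_log_branch_def exp_diff holomorphic_on_diff)
  then show ?thesis by blast
qed

lemma log_branch_unique:
  assumes F: "is_log_branch f F" and G: "is_log_branch f G" and z: "z \<in> unit_disc"
  shows "F z = G z"
proof -
  have hol: "F holomorphic_on unit_disc" "G holomorphic_on unit_disc"
    using F G by (auto simp: is_log_branch_def)
  have eq: "exp (F z) = exp (G z)" if "z \<in> unit_disc" for z
    using F G that by (cases "z = 0") (auto simp: is_log_branch_def)
  have dv: "((\<lambda>z. F z - G z) has_field_derivative 0) (at z)" if zz: "z \<in> unit_disc" for z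
  proof -
    have dF: "(F has_field_derivative deriv F z) (at z)"
      and dG: "(G has_field_derivative deriv G z) (at z)"
      using hol zz by (auto intro!: holomorphic_derivI[where S = unit_disc])
    have "((\<lambda>z. exp (F z)) has_field_derivative exp (F z) * deriv F z) (at z)"
      using dF by (auto intro!: derivative_eq_intros)
    then have "((\<lambda>z. exp (G z)) has_field_derivative exp (F z) * deriv F z) (at z)"
      by (rule has_field_derivative_transform_within_open[OF _ open_ball zz]) (use eq in auto)
    moreover have "((\<lambda>z. exp (G z)) has_field_derivative exp (G z) * deriv G z) (at z)"
      using dG by (auto intro!: derivative_eq_intros)
    ultimately have "exp (F z) * deriv F z = exp (G z) * deriv G z"
      by (rule DERIV_unique)
    then have "deriv F z = deriv G z"
      using eq[OF zz] by simp
    then show ?thesis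
      using DERIV_diff[OF dF dG] by simp
  qed
  obtain c where "\<And>z. z \<in> unit_disc \<Longrightarrow> F z - G z = c"
    using has_field_derivative_zero_constant[of unit_disc "\<lambda>z. F z - G z"] dv
    by (meson convex_ball has_field_derivative_at_within)
  from this[OF z] this[of 0] show ?thesis
    using F G by (simp add: is_log_branch_def)
qed

lemma log_coeff_sums:
  assumes "f \<in> class_S" and z: "z \<in> unit_disc"
  shows "(\<lambda>n. 2 * log_coeff f n * z ^ n) sums log_fun f z" and "log_coeff f 0 = 0"
proof -
  have L: "is_log_branch f (log_fun f)"
    unfolding log_fun_def using log_branch_ex[OF assms(1)] by (rule someI_ex)
  then show "(\<lambda>n. 2 * log_coeff f n * z ^ n) sums log_fun f z"
    using holomorphic_power_series[of "log_fun f" 0 1 z] z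
    by (auto simp: is_log_branch_def log_coeff_def)
  show "log_coeff f 0 = 0"
    using L by (simp add: is_log_branch_def log_coeff_def)
qed

end

theory Submission
  imports Defs
begin

text \<open>
  Write \<open>z f'/f = 1 + (2/\<pi>) arcsin \<omega>\<close> and let \<open>c\<^sub>n\<close> be the Taylor coefficients of \<open>\<omega>\<close>. Since
  \<open>z f'/f = 1 + z F'\<close> for \<open>F = log (f z / z)\<close>, comparing coefficients in \<open>sin (\<pi>/2 \<cdot> z F') = \<omega>\<close> gives
  \<open>\<pi>\<^sup>2 (\<gamma>\<^sub>1 \<gamma>\<^sub>3 - \<gamma>\<^sub>2\<^sup>2) = c\<^sub>1 c\<^sub>3 / 3 + c\<^sub>1\<^sup>4 / 18 - c\<^sub>2\<^sup>2 / 4\<close>. By AM-GM and \<open>\<bar>c\<^sub>1\<bar> \<le> 1\<close> the modulus of this is at most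
  \<open>(\<bar>c\<^sub>1\<bar>\<^sup>2 + \<bar>c\<^sub>2\<bar>\<^sup>2 + \<bar>c\<^sub>3\<bar>\<^sup>2) / 4\<close>, and Bessel's inequality for the bounded function \<open>\<omega>\<close> bounds the
  bracket by 1. Equality holds for \<open>\<omega> z = z\<^sup>2\<close>; the corresponding \<open>f\<close> is univalent because
  \<open>s \<mapsto> log (f (e\<^sup>s)) = s + F (e\<^sup>s)\<close> has a derivative with positive real part on the left half-plane.
\<close>

section \<open>Taylor coefficients as circle means, and Bessel's inequality on the disc\<close>

lemma has_integral_circle_coeff:
  assumes hol: "h holomorphic_on ball 0 R" and h: "h has_fps_expansion H"
    and r: "0 < r" "r < R"
  shows "((\<lambda>t. h (circlepath 0 r t) / circlepath 0 r t ^ k) has_integral fps_nth H k) {0..1}"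
proof -
  have "((\<lambda>u. h u / (u - 0) ^ Suc k) has_contour_integral
      (2 * pi * \<i>) / fact k * (deriv ^^ k) h 0) (circlepath 0 r)"
    by (rule Cauchy_has_contour_integral_higher_derivative_circlepath)
       (use r in \<open>auto intro!: holomorphic_on_subset[OF hol] holomorphic_on_imp_continuous_on\<close>)
  \<comment> \<open>On a circle about 0 the derivative is 2 pi i times the point itself; this
    cancels one power of the denominator and turns Cauchy's integral into a plain mean over
    \<open>{0..1}\<close>.\<close>
  moreover have "vector_derivative (circlepath 0 r) (at t) = 2 * pi * \<i> * circlepath 0 r t" for t
    by (simp only: vector_derivative_circlepath) (simp add: circlepath)
  ultimately have "((\<lambda>t. h (circlepath 0 r t) / circlepath 0 r t ^ Suc k *
      (2 * pi * \<i> * circlepath 0 r t)) has_integral (2 * pi * \<i>) / fact k * (deriv ^^ k) h 0) {0..1}"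
    unfolding has_contour_integral by simp
  then have "((\<lambda>t. h (circlepath 0 r t) / circlepath 0 r t ^ Suc k *
      (2 * pi * \<i> * circlepath 0 r t) / (2 * pi * \<i>)) has_integral
      ((2 * pi * \<i>) / fact k * (deriv ^^ k) h 0) / (2 * pi * \<i>)) {0..1}"
    by (rule has_integral_divide)
  moreover have "circlepath 0 r t \<noteq> 0" for t
    using r by (simp add: circlepath)
  ultimately show ?thesis
    by (simp add: fps_nth_fps_expansion[OF h] field_simps)
qed

text \<open>With p the Taylor polynomial of f, Re ((2 f - p) cnj p) = |f|^2 - |f - p|^2 is at most
  M^2. Its mean over the circle of radius r is a finite sum of Cauchy means, so no infinite Parseval
  identity enters. Then r tends to 1.\<close>

lemma bessel_inequality_disc:
  assumes hol: "f holomorphic_on ball 0 1" and f: "f has_fps_expansion F"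
    and le: "\<And>z. z \<in> ball 0 1 \<Longrightarrow> norm (f z) \<le> M"
  shows "(\<Sum>k\<le>n. (norm (fps_nth F k))\<^sup>2) \<le> M\<^sup>2"
proof -
  define a where "a = fps_nth F"
  define p where "p = (\<lambda>z. \<Sum>k\<le>n. a k * z ^ k)"
  define h where "h = (\<lambda>z. 2 * f z - p z)"
  define H where "H = 2 * F - (\<Sum>k\<le>n. fps_const (a k) * fps_X ^ k)"
  have h: "h has_fps_expansion H"
    unfolding h_def H_def p_def by (intro fps_expansion_intros f)
  have H: "fps_nth H k = a k" if "k \<le> n" for k
    using that by (simp add: H_def fps_sum_nth a_def numeral_fps_const if_distrib[of "\<lambda>x. _ * x"]
        sum.delta' cong: if_cong)
  have hhol: "h holomorphic_on ball 0 1"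
    unfolding h_def p_def by (intro holomorphic_intros hol)
  have bound: "(\<Sum>k\<le>n. (norm (a k))\<^sup>2 * (r\<^sup>2) ^ k) \<le> M\<^sup>2" if r: "0 < r" "r < 1" for r :: real
  proof -
    let ?\<gamma> = "circlepath 0 r"
    have nz: "?\<gamma> t \<noteq> 0" and nr: "norm (?\<gamma> t) = r" for t
      using r by (simp_all add: circlepath norm_mult norm_exp_eq_Re)
    \<comment> \<open>On the circle this makes \<open>cnj (p z)\<close> a polynomial in 1/z, so each
      term of \<open>h * cnj p\<close> picks out one coefficient of \<open>h\<close>.\<close>
    have cnj_eq: "cnj (?\<gamma> t) = of_real (r\<^sup>2) / ?\<gamma> t" for t
      using nz[of t] nr[of t] by (simp add: field_simps complex_norm_square[symmetric])
    have "((\<lambda>t. \<Sum>k\<le>n. cnj (a k) * of_real (r\<^sup>2) ^ k * (h (?\<gamma> t) / ?\<gamma> t ^ k)) has_integral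
        (\<Sum>k\<le>n. cnj (a k) * of_real (r\<^sup>2) ^ k * fps_nth H k)) {0..1}"
      by (intro has_integral_sum has_integral_mult_right has_integral_circle_coeff[OF hhol h r])
        auto
    also have "(\<lambda>t. \<Sum>k\<le>n. cnj (a k) * of_real (r\<^sup>2) ^ k * (h (?\<gamma> t) / ?\<gamma> t ^ k)) =
        (\<lambda>t. h (?\<gamma> t) * cnj (p (?\<gamma> t)))"
      by (simp add: p_def cnj_eq power_divide sum_distrib_left mult_ac)
    also have "(\<Sum>k\<le>n. cnj (a k) * of_real (r\<^sup>2) ^ k * fps_nth H k) =
        of_real (\<Sum>k\<le>n. (norm (a k))\<^sup>2 * (r\<^sup>2) ^ k)"
      unfolding of_real_sum of_real_mult complex_norm_square
      by (rule sum.cong) (auto simp: H)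
    finally have "((\<lambda>t. Re (h (?\<gamma> t) * cnj (p (?\<gamma> t)))) has_integral
        (\<Sum>k\<le>n. (norm (a k))\<^sup>2 * (r\<^sup>2) ^ k)) {0..1}"
      using has_integral_Re Re_complex_of_real by metis
    moreover have "((\<lambda>t::real. M\<^sup>2) has_integral M\<^sup>2) {0..1}"
      using has_integral_const_real[of "M\<^sup>2" 0 1] by simp
    moreover have "Re (h (?\<gamma> t) * cnj (p (?\<gamma> t))) \<le> M\<^sup>2" for t
    proof -
      have "Re ((2 * w - q) * cnj q) = (norm w)\<^sup>2 - (norm (w - q))\<^sup>2" for w q
        unfolding cmod_power2 by (simp add: power2_eq_square algebra_simps)
      then have "Re (h (?\<gamma> t) * cnj (p (?\<gamma> t))) \<le> (norm (f (?\<gamma> t)))\<^sup>2"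
        by (simp add: h_def)
      also have "\<dots> \<le> M\<^sup>2"
        using le[of "?\<gamma> t"] nr[of t] r by (intro power_mono) auto
      finally show ?thesis .
    qed
    ultimately show ?thesis
      by (rule has_integral_le)
  qed
  have "((\<lambda>r. \<Sum>k\<le>n. (norm (a k))\<^sup>2 * (r\<^sup>2) ^ k) \<longlongrightarrow> (\<Sum>k\<le>n. (norm (a k))\<^sup>2 * (1\<^sup>2) ^ k)) (at_left (1::real))"
    by (intro tendsto_intros)
  then have "(\<Sum>k\<le>n. (norm (a k))\<^sup>2 * (1\<^sup>2) ^ k) \<le> M\<^sup>2"
  proof (rule tendsto_upperbound)
    show "\<forall>\<^sub>F r in at_left (1::real). (\<Sum>k\<le>n. (norm (a k))\<^sup>2 * (r\<^sup>2) ^ k) \<le> M\<^sup>2"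
      using eventually_at_left_real[OF zero_less_one] by eventually_elim (rule bound, auto)
  qed simp
  then show ?thesis
    by (simp add: a_def)
qed

section \<open>The Hankel determinant in terms of the coefficients of the Schwarz function\<close>

lemma fps_sin_compose_nth:
  fixes A :: "'a::field_char_0 fps"
  assumes "fps_nth A 0 = 0"
  shows "fps_nth (fps_sin 1 oo A) 1 = fps_nth A 1"
    and "fps_nth (fps_sin 1 oo A) 2 = fps_nth A 2"
    and "fps_nth (fps_sin 1 oo A) 3 = fps_nth A 3 - fps_nth A 1 ^ 3 / 6"
proof -
  have "fps_nth (fps_sin (1::'a)) 0 = 0" "fps_nth (fps_sin (1::'a)) (Suc 0) = 1"
    "fps_nth (fps_sin (1::'a)) (Suc (Suc 0)) = 0"
    "fps_nth (fps_sin (1::'a)) (Suc (Suc (Suc 0))) = - 1 / 6"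
    by (simp_all add: fps_sin_def)
  then show "fps_nth (fps_sin 1 oo A) 1 = fps_nth A 1"
    and "fps_nth (fps_sin 1 oo A) 2 = fps_nth A 2"
    and "fps_nth (fps_sin 1 oo A) 3 = fps_nth A 3 - fps_nth A 1 ^ 3 / 6"
    using assms by (simp_all add: fps_compose_nth fps_mult_nth numeral_2_eq_2 numeral_3_eq_3)
qed

lemma norm_hankel_form_le:
  fixes a b c :: complex
  assumes "(norm a)\<^sup>2 + (norm b)\<^sup>2 + (norm c)\<^sup>2 \<le> 1"
  shows "norm (a * c / 3 + a ^ 4 / 18 - b\<^sup>2 / 4) \<le> 1 / 4"
proof -
  let ?x = "norm a" and ?y = "norm b" and ?z = "norm c"
  have "norm (a * c / 3 + a ^ 4 / 18 - b\<^sup>2 / 4) \<le> ?x * ?z / 3 + ?x ^ 4 / 18 + ?y\<^sup>2 / 4"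
    by (rule order.trans[OF norm_triangle_ineq4 add_mono[OF norm_triangle_le]])
      (simp_all add: norm_mult norm_divide norm_power)
  also have "?x * ?z \<le> (?x\<^sup>2 + ?z\<^sup>2) / 2"
    using sum_squares_bound[of ?x ?z] by simp
  also have "?x ^ 4 \<le> ?x\<^sup>2"
  proof -
    have "?x\<^sup>2 \<le> 1"
      using assms zero_le_power2[of ?y] zero_le_power2[of ?z] by linarith
    then have "?x\<^sup>2 * ?x\<^sup>2 \<le> ?x\<^sup>2 * 1"
      by (intro mult_left_mono) auto
    then show ?thesis
      by (simp add: power_add[symmetric])
  qed
  \<comment> \<open>The weights of the three squares are 1/6 + 1/18 = 2/9, 1/4 and 1/6, none above
    1/4.\<close>
  also have "(?x\<^sup>2 + ?z\<^sup>2) / 2 / 3 + ?x\<^sup>2 / 18 + ?y\<^sup>2 / 4 \<le> 1 / 4"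
    using assms zero_le_power2[of ?x] zero_le_power2[of ?z] by argo
  finally show ?thesis by simp
qed

text \<open>Logarithmic differentiation of f z = z exp (F z) away from 0; at 0 both sides are 1 by
  convention.\<close>

lemma starlike_quotient_log_branch:
  assumes F: "is_log_branch f F" and z: "z \<in> unit_disc"
  shows "starlike_quotient f z = 1 + z * deriv F z"
proof (cases "z = 0")
  case False
  have hol: "F holomorphic_on unit_disc"
    using F by (simp add: is_log_branch_def)
  have eq: "w * exp (F w) = f w" if "w \<in> unit_disc - {0}" for w
    using F that by (auto simp: is_log_branch_def)
  have "((\<lambda>w. w * exp (F w)) has_field_derivative exp (F z) + z * (exp (F z) * deriv F z)) (at z)"
    using holomorphic_derivI[OF hol open_ball z] by (auto intro!: derivative_eq_intros)
  then have "(f has_field_derivative exp (F z) + z * (exp (F z) * deriv F z)) (at z)"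
    by (rule has_field_derivative_transform_within_open[where S = "unit_disc - {0}"])
      (use False z eq in auto)
  then show ?thesis
    using False eq[of z] z by (simp add: DERIV_imp_deriv starlike_quotient_def field_simps
        flip: eq)
qed (simp add: starlike_quotient_def)

text \<open>Serves both the bound and the extremal function. Applying sin to both sides means that
  only the series of sin is expanded, never that of \<open>Arcsin\<close>.\<close>

lemma hankel_log_2_1_eq:
  assumes f: "f \<in> class_S" and W: "\<omega> has_fps_expansion W"
    and eq: "\<And>z. z \<in> unit_disc \<Longrightarrow> starlike_quotient f z = 1 + 2 / of_real pi * Arcsin (\<omega> z)"
  shows "hankel_log_2_1 f = (fps_nth W 1 * fps_nth W 3 / 3 + fps_nth W 1 ^ 4 / 18
           - (fps_nth W 2)\<^sup>2 / 4) / of_real (pi\<^sup>2)"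
proof -
  define F where "F = log_fun f"
  have L: "is_log_branch f F"
    unfolding F_def log_fun_def using log_branch_ex[OF f] by (rule someI_ex)
  define P where "P = fps_expansion F 0"
  have P: "F has_fps_expansion P"
    unfolding P_def using L
    by (intro has_fps_expansion_fps_expansion[of unit_disc]) (auto simp: is_log_branch_def)
  have coeff: "log_coeff f n = fps_nth P n / 2" for n
    by (simp add: log_coeff_def F_def P_def fps_expansion_def)
  \<comment> \<open>The n-th coefficient is (pi/2) * n * (2 \<gamma>_n) = n pi \<gamma>_n.\<close>
  define A where "A = fps_const (of_real pi / 2) * (fps_X * fps_deriv P)"
  have "(\<lambda>z. of_real pi / 2 * (z * deriv F z)) has_fps_expansion A"
    unfolding A_def by (intro fps_expansion_intros P)
  then have "(sin \<circ> (\<lambda>z. of_real pi / 2 * (z * deriv F z))) has_fps_expansion (fps_sin 1 oo A)"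
    by (intro has_fps_expansion_compose has_fps_expansion_sin') (simp_all add: A_def)
  moreover have "(sin \<circ> (\<lambda>z. of_real pi / 2 * (z * deriv F z))) z = \<omega> z" if "z \<in> unit_disc" for z
  proof -
    have "of_real pi / 2 * (z * deriv F z) = Arcsin (\<omega> z)"
      using eq[OF that] starlike_quotient_log_branch[OF L that] by (simp add: field_simps)
    then show ?thesis by simp
  qed
  then have "\<forall>\<^sub>F z in nhds 0. (sin \<circ> (\<lambda>z. of_real pi / 2 * (z * deriv F z))) z = \<omega> z"
    using eventually_nhds_in_open[of unit_disc 0] by (auto elim: eventually_mono)
  ultimately have "\<omega> has_fps_expansion (fps_sin 1 oo A)"
    using has_fps_expansion_cong by blast
  then have "W = fps_sin 1 oo A"
    using W fps_expansion_unique_complex by blast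
  moreover have "fps_nth A 0 = 0" "fps_nth A 1 = of_real pi * log_coeff f 1"
    "fps_nth A 2 = 2 * of_real pi * log_coeff f 2" "fps_nth A 3 = 3 * of_real pi * log_coeff f 3"
    by (simp_all add: A_def coeff numeral_eq_Suc)
  ultimately have W_nth: "fps_nth W 1 = of_real pi * log_coeff f 1"
    "fps_nth W 2 = 2 * of_real pi * log_coeff f 2"
    "fps_nth W 3 = 3 * of_real pi * log_coeff f 3 - (of_real pi * log_coeff f 1) ^ 3 / 6"
    using fps_sin_compose_nth[of A] by simp_all
  show ?thesis
    unfolding hankel_log_2_1_def W_nth
    by (simp add: field_simps power2_eq_square power4_eq_xxxx power3_eq_cube del: One_nat_def)
qed

section \<open>Univalence of starlike functions and construction of members of the class\<close>

lemma inj_on_Re_deriv_pos: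
  assumes S: "convex S" and der: "\<And>z. z \<in> S \<Longrightarrow> (f has_field_derivative f' z) (at z)"
    and pos: "\<And>z. z \<in> S \<Longrightarrow> Re (f' z) > 0"
  shows "inj_on f S"
proof (rule inj_onI, rule ccontr)
  fix w z assume wz: "w \<in> S" "z \<in> S" "f w = f z" "w \<noteq> z"
  have sub: "closed_segment w z \<subseteq> S"
    using S wz by (simp add: closed_segment_subset)
  \<comment> \<open>Noshiro-Warschawski argument: the mean value theorem for f / (z - w) yields a
    point u with Re (f' u) = 0 when f w = f z.\<close>
  have "\<exists>u. u \<in> closed_segment w z \<and>
      Re (f z / (z - w)) - Re (f w / (z - w)) = Re (f' u / (z - w) * (z - w))"
    by (rule complex_mvt_line) (use sub in \<open>auto intro!: DERIV_cdivide der\<close>)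
  then show False
    using wz sub pos by force
qed

text \<open>The substitution z = exp s moves the problem to a convex half-plane, where
  \<open>L\<close> has derivative 1 + z F' and is injective by the previous lemma. Only the
  ambiguity of the logarithm remains to be handled.\<close>

lemma inj_on_starlike:
  assumes hol: "F holomorphic_on unit_disc"
    and pos: "\<And>z. z \<in> unit_disc \<Longrightarrow> Re (1 + z * deriv F z) > 0"
  shows "inj_on (\<lambda>z. z * exp (F z)) unit_disc"
proof (rule inj_onI)
  fix w z assume wz: "w \<in> unit_disc" "z \<in> unit_disc" "w * exp (F w) = z * exp (F z)"
  define L where "L = (\<lambda>s. s + F (exp s))"
  have inj: "inj_on L {s. Re s < 0}"
  proof (rule inj_on_Re_deriv_pos)
    fix s assume "s \<in> {s. Re s < 0}"
    then have s: "exp s \<in> unit_disc" by (simp add: norm_exp_eq_Re)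
    have "((\<lambda>s. F (exp s)) has_field_derivative deriv F (exp s) * exp s) (at s)"
      by (rule DERIV_chain2[OF holomorphic_derivI[OF hol open_ball s] DERIV_exp])
    then show "(L has_field_derivative 1 + exp s * deriv F (exp s)) (at s)"
      unfolding L_def by (auto intro!: derivative_eq_intros)
    show "Re (1 + exp s * deriv F (exp s)) > 0"
      by (rule pos[OF s])
  qed (simp add: convex_halfspace_Re_lt)
  show "w = z"
  proof (cases "w = 0 \<or> z = 0")
    case False
    define s t where "s = Ln w" and "t = Ln z"
    have st: "exp s = w" "exp t = z"
      using False by (simp_all add: s_def t_def)
    have "exp (L s) = exp (L t)"
      using wz by (simp add: L_def exp_add st)
    then obtain n :: int where n: "L s = L t + of_real (2 * n * pi) * \<i>"
      by (auto simp: exp_eq)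
    \<comment> \<open>L (t + 2 pi i n) = L t + 2 pi i n, so a shift of \<open>t\<close> absorbs the
      period without changing exp t.\<close>
    define u where "u = t + of_real (2 * n * pi) * \<i>"
    have u: "exp u = z"
      unfolding u_def st(2)[symmetric] by (subst exp_eq) auto
    have "L s = L u"
      using n u st by (simp add: L_def u_def)
    moreover have "Re s < 0" "Re u < 0"
      using wz(1,2) norm_exp_eq_Re[of s] norm_exp_eq_Re[of u] st u by auto
    ultimately have "s = u"
      using inj by (auto dest: inj_onD)
    then show ?thesis using st u by simp
  qed (use wz in auto)
qed

text \<open>Solves z F' = (2/pi) arcsin \<omega> for F and puts f z = z exp (F z). The strict bound
  keeps \<omega> where \<open>Arcsin\<close> is holomorphic and has real part strictly between -pi/2
  and pi/2.\<close>

lemma ex_S_star_arcsin: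
  assumes \<omega>: "\<omega> holomorphic_on unit_disc" "\<omega> 0 = 0"
    and less: "\<And>z. z \<in> unit_disc \<Longrightarrow> norm (\<omega> z) < 1"
  obtains f where "f \<in> S_star_arcsin"
    "\<And>z. z \<in> unit_disc \<Longrightarrow> starlike_quotient f z = 1 + 2 / of_real pi * Arcsin (\<omega> z)"
proof -
  define g where "g = (\<lambda>z. 2 / of_real pi * Arcsin (\<omega> z))"
  have Arcsin_hol: "Arcsin holomorphic_on unit_disc"
    by (rule holomorphic_on_Arcsin) (use abs_Re_le_cmod order.strict_trans1 in fastforce)
  have g_hol: "g holomorphic_on unit_disc"
    unfolding g_def
    by (intro holomorphic_intros holomorphic_on_compose_gen[OF \<omega>(1) Arcsin_hol, unfolded o_def])
      (use less in auto)
  have g0: "g 0 = 0"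
    by (simp add: g_def \<omega>)
  \<comment> \<open>The value at 0 removes the singularity of g z / z, so \<open>q\<close> has a
    primitive on the disc.\<close>
  define q where "q = (\<lambda>z. if z = 0 then deriv g 0 else g z / z)"
  have "q holomorphic_on unit_disc"
    by (rule pole_theorem_open_0[OF g_hol, of 0]) (auto simp: q_def g0)
  then obtain G where "\<And>z. z \<in> unit_disc \<Longrightarrow> (G has_field_derivative q z) (at z within unit_disc)"
    using holomorphic_convex_primitive'[OF convex_ball open_ball] by blast
  then have G: "(G has_field_derivative q z) (at z)" if "z \<in> unit_disc" for z
    using that at_within_open[OF that open_ball] by metis
  define F where "F = (\<lambda>z. G z - G 0)"
  have F: "(F has_field_derivative q z) (at z)" if "z \<in> unit_disc" for z
    unfolding F_def using G[OF that] by (auto intro!: derivative_eq_intros)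
  have F_hol: "F holomorphic_on unit_disc"
    using F holomorphic_on_open[OF open_ball] by blast
  have zF: "z * deriv F z = g z" if "z \<in> unit_disc" for z
    using DERIV_imp_deriv[OF F[OF that]] by (simp add: q_def g0)
  define f where "f = (\<lambda>z. z * exp (F z))"
  \<comment> \<open>The factor 2/pi scales the strip |Re| < pi/2 to |Re| < 1, hence Re g >
    -1.\<close>
  have pos: "Re (1 + z * deriv F z) > 0" if "z \<in> unit_disc" for z
  proof -
    have "\<bar>Re (\<omega> z)\<bar> < 1"
      using less[OF that] abs_Re_le_cmod[of "\<omega> z"] by linarith
    then have "\<bar>Re (Arcsin (\<omega> z))\<bar> < pi / 2"
      by (rule Arcsin_bounds)
    moreover have "Re (g z) = 2 / pi * Re (Arcsin (\<omega> z))"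
    proof -
      have "g z = of_real (2 / pi) * Arcsin (\<omega> z)"
        by (simp add: g_def)
      then show ?thesis
        by (simp only: times_complex.sel Re_complex_of_real Im_complex_of_real)
    qed
    ultimately have "0 < pi * (1 + Re (g z))"
      by (simp add: distrib_left abs_less_iff)
    then show ?thesis
      using zF[OF that] by (simp add: zero_less_mult_iff)
  qed
  have F0: "F 0 = 0"
    by (simp add: F_def)
  then have "(f has_field_derivative 1) (at 0)"
    unfolding f_def using F[of 0] by (auto intro!: derivative_eq_intros)
  then have f_S: "f \<in> class_S"
    using inj_on_starlike[OF F_hol pos] F_hol unfolding class_S_def class_A_def f_def
    by (auto intro!: holomorphic_intros DERIV_imp_deriv)
  have "is_log_branch f F"
    using F_hol by (simp add: is_log_branch_def f_def F0)
  then have eq: "starlike_quotient f z = 1 + g z" if "z \<in> unit_disc" for z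
    using starlike_quotient_log_branch zF that by metis
  have "subordinate (starlike_quotient f) (\<lambda>z. 1 + 2 / of_real pi * Arcsin z)"
    unfolding subordinate_def
  proof (intro conjI exI ballI)
    show "starlike_quotient f holomorphic_on unit_disc"
      by (rule holomorphic_transform[of "\<lambda>z. 1 + g z"])
        (auto intro!: holomorphic_intros g_hol simp: eq)
    show "(\<lambda>z. 1 + 2 / of_real pi * Arcsin z) holomorphic_on unit_disc"
      by (intro holomorphic_intros Arcsin_hol) auto
    show "schwarz_function \<omega>"
      using \<omega> less by (auto simp: schwarz_function_def intro: less_imp_le)
  qed (simp add: eq g_def)
  then show thesis
    using that[of f] f_S eq by (simp add: S_star_arcsin_def g_def)
qed

theorem theorem4p2:
  shows "(\<forall>f \<in> S_star_arcsin. norm (hankel_log_2_1 f) \<le> 1 / (4 * pi\<^sup>2)) \<and>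
         (\<exists>f \<in> S_star_arcsin. norm (hankel_log_2_1 f) = 1 / (4 * pi\<^sup>2))"
proof (intro conjI ballI)
  fix f assume "f \<in> S_star_arcsin"
  then obtain \<omega> where f: "f \<in> class_S" and \<omega>: "schwarz_function \<omega>"
    and eq: "\<And>z. z \<in> unit_disc \<Longrightarrow> starlike_quotient f z = 1 + 2 / of_real pi * Arcsin (\<omega> z)"
    by (auto simp: S_star_arcsin_def subordinate_def)
  have hol: "\<omega> holomorphic_on unit_disc"
    using \<omega> by (simp add: schwarz_function_def)
  define W where "W = fps_expansion \<omega> 0"
  have W: "\<omega> has_fps_expansion W"
    unfolding W_def using hol by (intro has_fps_expansion_fps_expansion[of unit_disc]) auto
  have "(\<Sum>k\<le>3. (norm (fps_nth W k))\<^sup>2) \<le> 1\<^sup>2"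
    using \<omega> by (intro bessel_inequality_disc[OF hol W]) (auto simp: schwarz_function_def)
  moreover have "fps_nth W 0 = 0"
    using \<omega> by (simp add: W_def fps_expansion_def schwarz_function_def)
  ultimately have "(norm (fps_nth W 1))\<^sup>2 + (norm (fps_nth W 2))\<^sup>2 + (norm (fps_nth W 3))\<^sup>2 \<le> 1"
    by (simp add: numeral_eq_Suc)
  from divide_right_mono[OF norm_hankel_form_le[OF this], of "pi\<^sup>2"]
  show "norm (hankel_log_2_1 f) \<le> 1 / (4 * pi\<^sup>2)"
    by (subst hankel_log_2_1_eq[OF f W]) (simp_all add: eq norm_divide norm_power)
next
  obtain f where f: "f \<in> S_star_arcsin" and
    eq: "\<And>z. z \<in> unit_disc \<Longrightarrow> starlike_quotient f z = 1 + 2 / of_real pi * Arcsin (z\<^sup>2)"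
    by (rule ex_S_star_arcsin[of "\<lambda>z. z\<^sup>2"])
      (auto intro!: holomorphic_intros simp: norm_power power_less_one_iff)
  have "(\<lambda>z::complex. z\<^sup>2) has_fps_expansion fps_X\<^sup>2"
    by (intro fps_expansion_intros)
  \<comment> \<open>Here c_1 = c_3 = 0 and c_2 = 1, so the form equals -1/4.\<close>
  from hankel_log_2_1_eq[OF _ this eq] f
  have "norm (hankel_log_2_1 f) = 1 / (4 * pi\<^sup>2)"
    by (simp add: S_star_arcsin_def norm_divide norm_power)
  then show "\<exists>f \<in> S_star_arcsin. norm (hankel_log_2_1 f) = 1 / (4 * pi\<^sup>2)"
    using f by blast
qed

end
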